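(* Let $R$ be a distribution distance function on $\mathcal D_n$ and $r\ge0$. The robust estimation formulation $$z^{r}\in\arg\min_z\ c_n(z,D_{\mathrm{tr}},x_0),\qquad c_n(z,D_{\mathrm{tr}},x_0)=\sup\{\mathrm E^n_D[L(z,y)\mid x=x_0]:\ D\in\mathcal D_n,\ R(D,D_{\mathrm{tr}})\le r\},$$ can be reformulated as a convex optimization problem, namely $$\arg\min_z\ c_n(z,D_{\mathrm{tr}},x_0)=\arg\min_z\ \max_{j\in\{1,\dots,n\}}c^j_n(z,D_{\mathrm{tr}},x_0),$$ where the objective $z\mapsto\max_{j}c^j_n(z,D_{\mathrm{tr}},x_0)$ is convex and, for $D\in\mathcal D_n$, $c^j_n(z,D,x_0)$ is the optimal value of the concave maximization problem $$\begin{array}{rl}\displaystyle\sup_{s>0,\,P\ge 0}&\sum_{(\bar x,\bar y)\in N^j_n(x_0)}w_n(\bar x,x_0)\,L(z,\bar y)\,P[\bar x,\bar y]\\ \text{s.t.}& s\,R(P/s,D)\le s\,r,\\ &\sum_{(\bar x,\bar y)\in\Omega_n}P[\bar x,\bar y]=s,\quad\sum_{(\bar x,\bar y)\in N^j_n(x_0)}w_n(\bar x,x_0)P[\bar x,\bar y]=1,\\ &\sum_{(\bar x,\bar y)\in N^j_n(x_0)}P[\bar x,\bar y]\ge s\,\frac kn,\quad\sum_{(\bar x,\bar y)\in N^{j-1}_n(x_0)}P[\bar x,\bar y]\le s\,\frac{k-1}n\end{array}$$ over $s>0$ and $P:\Omega_n\to[0,\infty)$.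
   Context: Data. Let $\bar d_1=(\bar x_1,\bar y_1),\dots,\bar d_n=(\bar x_n,\bar y_n)$ be a fixed finite list (training data, $n\ge1$) of points in $\Omega\subseteq\mathbb R^{\dim(x)}\times\mathbb R^{\dim(y)}$, let $\Omega_n$ be the finite set of distinct points in the list, $\mathcal D_n$ the set of all probability distributions on $\Omega_n$, and $D_{\mathrm{tr}}=\frac1n\sum_{i=1}^n\delta_{\bar d_i}\in\mathcal D_n$ the empirical training distribution. Fix a context of interest $x_0\in\mathbb R^{\dim(x)}$. Neighborhoods. $\mathrm{dist}(\bar d,x_0)\ge0$ is a distance function with the discrimination property $\mathrm{dist}(\bar d,x_0)=\mathrm{dist}(\bar d',x_0)\iff\bar d=\bar d'$. For $j\in\{1,\dots,n\}$ let $R^j_n=\min\{\rho\ge0:\ |\{i\le n:\mathrm{dist}(\bar d_i,x_0)\le\rho\}|\ge j\}$ (counted with multiplicity) and $N^j_n(x_0)=\{\bar d\in\Omega_n:\mathrm{dist}(\bar d,x_0)\le R^j_n\}$; put $N^0_n(x_0)=\emptyset$. Weights and loss. $w_n(\bar x,x_0)>0$ is a positive weighing function. $L(z,\bar y)\in\mathbb R_+\cup\{+\infty\}$ is convex in the decision $z\in\mathbb R^{\dim(z)}$ for each $\bar y$ and measurable in $\bar y$ for each $z$. Conventions: $0\cdot(+\infty)=0$, $\sup\emptyset=-\infty$. Fix $k\in\{1,\dots,n\}$. Estimator. For $D\in\mathcal D_n$ and $j\in\{1,\dots,n\}$ the partial estimator $\mathrm E^{n,j}_D[L(z,y)\mid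 x=x_0]$ is the supremum of $\sum_{N^j_n(x_0)}w_n(\bar x,x_0)L(z,\bar y)P[\bar x,\bar y]$ over $s>0$ and $P:\Omega_n\to[0,\infty)$ subject to $s\,D=P$ on $\Omega_n$, $\sum_{\Omega_n}P=s$, $\sum_{N^j_n(x_0)}w_n(\bar x,x_0)P[\bar x,\bar y]=1$, $\sum_{N^j_n(x_0)}P\ge\frac kn s$, $\sum_{N^{j-1}_n(x_0)}P\le\frac{k-1}n s$. The estimator is $\mathrm E^n_D[L(z,y)\mid x=x_0]=\max_{j\in\{1,\dots,n\}}\mathrm E^{n,j}_D[L(z,y)\mid x=x_0]$. (For empirical distributions of data lists of length $n$ on $\Omega_n$ this is the $w_n$-weighted average of the loss over the smallest neighborhood $N^j_n(x_0)$ containing at least $k$ observations.) Distribution distance function. A function $R:\mathcal D_n\times\mathcal D_n\to[0,+\infty]$ such that (i) $R(D,D')\ge0$ for all $D,D'$, and $R(D',D)=0$ iff $D'=D$; (ii) $D\mapsto R(D,D')$ is convex for each fixed $D'$. *)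

theory Defs
  imports "HOL-Analysis.Analysis"
begin

section \<open>Arrays and distributions on a finite set\<close>

text \<open>A function on a finite set \<open>S\<close> is represented by a total function that vanishes outside
  \<open>S\<close>, so that equality of functions is equality on \<open>S\<close>.\<close>

definition nonneg_arrays :: "'d set \<Rightarrow> ('d \<Rightarrow> real) set" where
  "nonneg_arrays S = {P. (\<forall>d\<in>S. 0 \<le> P d) \<and> (\<forall>d. d \<notin> S \<longrightarrow> P d = 0)}"

definition distributions :: "'d set \<Rightarrow> ('d \<Rightarrow> real) set" where
  "distributions S = {D \<in> nonneg_arrays S. (\<Sum>d\<in>S. D d) = 1}"

definition empirical :: "'d list \<Rightarrow> 'd \<Rightarrow> real" where
  "empirical ds d = (\<Sum>i<length ds. indicator {ds ! i} d) / real (length ds)"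

definition mix :: "real \<Rightarrow> ('d \<Rightarrow> real) \<Rightarrow> ('d \<Rightarrow> real) \<Rightarrow> ('d \<Rightarrow> real)" where
  "mix u f g = (\<lambda>d. u * f d + (1 - u) * g d)"

section \<open>Convexity for extended-real functions\<close>

text \<open>The constant \<^const>\<open>convex_on\<close> does not apply to extended-real values; convexity is
  convexity of the epigraph. For functions that avoid \<open>-\<infinity>\<close> this is Jensen's inequality.\<close>

definition convex_ereal :: "('z::real_vector \<Rightarrow> ereal) \<Rightarrow> bool" where
  "convex_ereal f \<longleftrightarrow> convex {(z, t::real). f z \<le> ereal t}"

text \<open>Function types carry no vector space structure in the library, so convex combinations of
  arrays are written with \<^const>\<open>mix\<close>. The functions \<open>R\<close> and \<open>f\<close> in the next two definitions
  take values in \<open>[0, \<infinity>]\<close>, so the convex combinations never add \<open>\<infinity>\<close> and \<open>-\<infinity>\<close>;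
  \<open>0 * \<infinity> = 0\<close> in \<^typ>\<open>ereal\<close>.\<close>

definition distribution_distance ::
    "'d set \<Rightarrow> (('d \<Rightarrow> real) \<Rightarrow> ('d \<Rightarrow> real) \<Rightarrow> ereal) \<Rightarrow> bool" where
  "distribution_distance S R \<longleftrightarrow>
     (\<forall>D\<in>distributions S. \<forall>D'\<in>distributions S. 0 \<le> R D D' \<and> (R D' D = 0 \<longleftrightarrow> D' = D)) \<and>
     (\<forall>D'\<in>distributions S. \<forall>D1\<in>distributions S. \<forall>D2\<in>distributions S. \<forall>u\<in>{0..1}.
        R (mix u D1 D2) D' \<le> ereal u * R D1 D' + ereal (1 - u) * R D2 D')"

text \<open>Maximization of a concave function \<open>f\<close> over a convex set \<open>F\<close> of pairs \<open>(s, P)\<close>.\<close>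

definition concave_maximization ::
    "(real \<times> ('d \<Rightarrow> real)) set \<Rightarrow> (real \<times> ('d \<Rightarrow> real) \<Rightarrow> ereal) \<Rightarrow> bool" where
  "concave_maximization F f \<longleftrightarrow>
     (\<forall>(s1, P1)\<in>F. \<forall>(s2, P2)\<in>F. \<forall>u\<in>{0..1}.
        (u * s1 + (1 - u) * s2, mix u P1 P2) \<in> F \<and>
        ereal u * f (s1, P1) + ereal (1 - u) * f (s2, P2)
          \<le> f (u * s1 + (1 - u) * s2, mix u P1 P2))"

section \<open>Neighborhoods and the weighted loss\<close>

definition radius :: "('d \<Rightarrow> 'x \<Rightarrow> real) \<Rightarrow> 'd list \<Rightarrow> 'x \<Rightarrow> nat \<Rightarrow> real" where
  "radius dst ds x0 j =
     (LEAST \<rho>. 0 \<le> \<rho> \<and> j \<le> card {i. i < length ds \<and> dst (ds ! i) x0 \<le> \<rho>})"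

definition nbhd :: "('d \<Rightarrow> 'x \<Rightarrow> real) \<Rightarrow> 'd list \<Rightarrow> 'x \<Rightarrow> nat \<Rightarrow> 'd set" where
  "nbhd dst ds x0 j =
     (if j = 0 then {} else {d \<in> set ds. dst d x0 \<le> radius dst ds x0 j})"

definition weighted_loss ::
    "('x \<Rightarrow> 'x \<Rightarrow> real) \<Rightarrow> ('z \<Rightarrow> 'y \<Rightarrow> ereal) \<Rightarrow> 'x \<Rightarrow> ('x \<times> 'y) set \<Rightarrow> 'z \<Rightarrow> ('x \<times> 'y \<Rightarrow> real) \<Rightarrow> ereal"
  where
  "weighted_loss w L x0 N z P = (\<Sum>(x, y)\<in>N. ereal (w x x0) * L z y * ereal (P (x, y)))"

text \<open>The constraints on \<open>(s, P)\<close> that the partial estimator and its robust counterpart share.\<close>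

definition nbhd_feasible ::
    "('x \<times> 'y \<Rightarrow> 'x \<Rightarrow> real) \<Rightarrow> ('x \<Rightarrow> 'x \<Rightarrow> real) \<Rightarrow> ('x \<times> 'y) list \<Rightarrow> 'x \<Rightarrow> nat \<Rightarrow> nat
      \<Rightarrow> (real \<times> ('x \<times> 'y \<Rightarrow> real)) set" where
  "nbhd_feasible dst w ds x0 k j =
     {(s, P). 0 < s \<and> P \<in> nonneg_arrays (set ds) \<and>
        (\<Sum>d\<in>set ds. P d) = s \<and>
        (\<Sum>(x, y)\<in>nbhd dst ds x0 j. w x x0 * P (x, y)) = 1 \<and>
        (\<Sum>d\<in>nbhd dst ds x0 j. P d) \<ge> s * (real k / real (length ds)) \<and>
        (\<Sum>d\<in>nbhd dst ds x0 (j - 1). P d) \<le> s * ((real k - 1) / real (length ds))}"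

section \<open>Nominal and robust estimators\<close>

definition partial_estimator ::
    "('x \<times> 'y \<Rightarrow> 'x \<Rightarrow> real) \<Rightarrow> ('x \<Rightarrow> 'x \<Rightarrow> real) \<Rightarrow> ('z \<Rightarrow> 'y \<Rightarrow> ereal) \<Rightarrow> ('x \<times> 'y) list \<Rightarrow> 'x
      \<Rightarrow> nat \<Rightarrow> nat \<Rightarrow> ('x \<times> 'y \<Rightarrow> real) \<Rightarrow> 'z \<Rightarrow> ereal" where
  "partial_estimator dst w L ds x0 k j D z =
     Sup {weighted_loss w L x0 (nbhd dst ds x0 j) z P | s P.
            (s, P) \<in> nbhd_feasible dst w ds x0 k j \<and> (\<forall>d\<in>set ds. s * D d = P d)}"

definition estimator ::
    "('x \<times> 'y \<Rightarrow> 'x \<Rightarrow> real) \<Rightarrow> ('x \<Rightarrow> 'x \<Rightarrow> real) \<Rightarrow> ('z \<Rightarrow> 'y \<Rightarrow> ereal) \<Rightarrow> ('x \<times> 'y) list \<Rightarrow> 'x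
      \<Rightarrow> nat \<Rightarrow> ('x \<times> 'y \<Rightarrow> real) \<Rightarrow> 'z \<Rightarrow> ereal" where
  "estimator dst w L ds x0 k D z =
     (MAX j\<in>{1..length ds}. partial_estimator dst w L ds x0 k j D z)"

definition robust_cost ::
    "('x \<times> 'y \<Rightarrow> 'x \<Rightarrow> real) \<Rightarrow> ('x \<Rightarrow> 'x \<Rightarrow> real) \<Rightarrow> ('z \<Rightarrow> 'y \<Rightarrow> ereal) \<Rightarrow> ('x \<times> 'y) list \<Rightarrow> 'x
      \<Rightarrow> nat \<Rightarrow> (('x \<times> 'y \<Rightarrow> real) \<Rightarrow> ('x \<times> 'y \<Rightarrow> real) \<Rightarrow> ereal) \<Rightarrow> real
      \<Rightarrow> ('x \<times> 'y \<Rightarrow> real) \<Rightarrow> 'z \<Rightarrow> ereal" where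
  "robust_cost dst w L ds x0 k R r D0 z =
     Sup {estimator dst w L ds x0 k D z | D. D \<in> distributions (set ds) \<and> R D D0 \<le> ereal r}"

definition robust_feasible ::
    "('x \<times> 'y \<Rightarrow> 'x \<Rightarrow> real) \<Rightarrow> ('x \<Rightarrow> 'x \<Rightarrow> real) \<Rightarrow> ('x \<times> 'y) list \<Rightarrow> 'x
      \<Rightarrow> nat \<Rightarrow> (('x \<times> 'y \<Rightarrow> real) \<Rightarrow> ('x \<times> 'y \<Rightarrow> real) \<Rightarrow> ereal) \<Rightarrow> real
      \<Rightarrow> nat \<Rightarrow> ('x \<times> 'y \<Rightarrow> real) \<Rightarrow> (real \<times> ('x \<times> 'y \<Rightarrow> real)) set" where
  "robust_feasible dst w ds x0 k R r j D =
     {(s, P) \<in> nbhd_feasible dst w ds x0 k j.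
        ereal s * R (\<lambda>d. P d / s) D \<le> ereal (s * r)}"

definition partial_robust_cost ::
    "('x \<times> 'y \<Rightarrow> 'x \<Rightarrow> real) \<Rightarrow> ('x \<Rightarrow> 'x \<Rightarrow> real) \<Rightarrow> ('z \<Rightarrow> 'y \<Rightarrow> ereal) \<Rightarrow> ('x \<times> 'y) list \<Rightarrow> 'x
      \<Rightarrow> nat \<Rightarrow> (('x \<times> 'y \<Rightarrow> real) \<Rightarrow> ('x \<times> 'y \<Rightarrow> real) \<Rightarrow> ereal) \<Rightarrow> real
      \<Rightarrow> nat \<Rightarrow> ('x \<times> 'y \<Rightarrow> real) \<Rightarrow> 'z \<Rightarrow> ereal" where
  "partial_robust_cost dst w L ds x0 k R r j D z =
     Sup {weighted_loss w L x0 (nbhd dst ds x0 j) z P | s P.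
            (s, P) \<in> robust_feasible dst w ds x0 k R r j D}"

definition argmin_set :: "('z \<Rightarrow> ereal) \<Rightarrow> 'z set" where
  "argmin_set f = {z. is_arg_min f (\<lambda>_. True) z}"

end

theory Submission
  imports Defs
begin

text \<open>A feasible point \<open>(s, P)\<close> of the \<open>j\<close>-th robust problem is a distribution \<open>D = P / s\<close> together
  with the scale \<open>s\<close> at which \<open>(s, s * D)\<close> is feasible for the partial estimator at \<open>D\<close>; the
  constraint \<open>s * R (P / s) D0 \<le> s * r\<close> says exactly that \<open>D\<close> lies in the ambiguity set
  \<open>R D D0 \<le> r\<close> around the reference distribution \<open>D0\<close>. Hence the
  \<open>j\<close>-th robust problem is the joint supremum over \<open>D\<close> and \<open>s\<close>, and since the maximum over \<open>j\<close>
  commutes with the supremum over \<open>D\<close>, the robust cost and the maximum of the partial robust costs are the same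
  function of \<open>z\<close> (lemma \<open>robust_cost_eq_Max\<close>). In particular they have the same minimizers.

  The change of variables is what makes the problem tractable. In \<open>(s, P)\<close> the neighborhood
  constraints and the objective are linear, and the distance constraint involves the perspective
  \<open>(s, P) \<mapsto> s * R (P / s) D0\<close> of a convex function, which is jointly convex
  (lemma \<open>perspective_distance_convex\<close>). So each inner problem maximizes a concave function over a
  convex set. Moreover its feasible set does not depend on \<open>z\<close>: the outer objective is
  a supremum of functions \<open>z \<mapsto> weighted_loss \<dots> z P\<close>, each a nonnegative combination of the convex
  losses, and therefore convex.\<close>

section \<open>Convexity of extended-real functions\<close>

text \<open>The epigraph only has real heights, so the Jensen inequality is read off from it at
  finite values. An infinite value makes the right-hand side infinite unless its weight vanishes;
  nonnegativity excludes \<open>\<infinity> - \<infinity>\<close>.\<close>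

lemma convex_ereal_Jensen:
  assumes "convex_ereal f" and nonneg: "\<And>z. 0 \<le> f z"
    and uv: "0 \<le> u" "0 \<le> v" "u + v = 1"
  shows "f (u *\<^sub>R a + v *\<^sub>R b) \<le> ereal u * f a + ereal v * f b"
proof -
  consider "u = 0" | "v = 0" | "0 < u" "0 < v" using uv by fastforce
  then show ?thesis
  proof cases
    case 1
    then show ?thesis using uv by (simp flip: zero_ereal_def)
  next
    case 2
    then show ?thesis using uv by (simp flip: zero_ereal_def)
  next
    case 3
    show ?thesis
    proof (cases "f a = \<infinity> \<or> f b = \<infinity>")
      case True
      then show ?thesis
        using 3 nonneg[of a] nonneg[of b] by (cases "f a"; cases "f b") auto
    next
      case False
      then obtain s t where st: "f a = ereal s" "f b = ereal t"
        using nonneg[of a] nonneg[of b] by (cases "f a"; cases "f b") auto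
      then have "(a, s) \<in> {(z, t::real). f z \<le> ereal t}" "(b, t) \<in> {(z, t::real). f z \<le> ereal t}"
        by auto
      then have "u *\<^sub>R (a, s) + v *\<^sub>R (b, t) \<in> {(z, t::real). f z \<le> ereal t}"
        using assms(1) uv unfolding convex_ereal_def by (intro convexD)
      then show ?thesis using st by simp
    qed
  qed
qed

lemma convex_ereal_if_Jensen:
  assumes "\<And>a b u v. 0 \<le> u \<Longrightarrow> 0 \<le> v \<Longrightarrow> u + v = 1 \<Longrightarrow>
      f (u *\<^sub>R a + v *\<^sub>R b) \<le> ereal u * f a + ereal v * f b"
  shows "convex_ereal f"
  unfolding convex_ereal_def
proof (rule convexI, clarsimp)
  fix a b s t and u v :: real
  assume le: "f a \<le> ereal s" "f b \<le> ereal t" and uv: "0 \<le> u" "0 \<le> v" "u + v = 1"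
  have "f (u *\<^sub>R a + v *\<^sub>R b) \<le> ereal u * f a + ereal v * f b"
    by (rule assms[OF uv])
  also have "\<dots> \<le> ereal u * ereal s + ereal v * ereal t"
    by (intro add_mono ereal_mult_left_mono le) (use uv in auto)
  finally show "f (u *\<^sub>R a + v *\<^sub>R b) \<le> ereal (u * s + v * t)"
    by simp
qed

text \<open>The epigraph of a supremum is the intersection of the epigraphs. This also covers the empty
  supremum \<open>-\<infinity>\<close>, whose epigraph is the whole space.\<close>

lemma convex_ereal_SUP:
  assumes "\<And>i. i \<in> I \<Longrightarrow> convex_ereal (f i)"
  shows "convex_ereal (\<lambda>z. SUP i\<in>I. f i z)"
proof -
  have "{(z, t::real). (SUP i\<in>I. f i z) \<le> ereal t} = (\<Inter>i\<in>I. {(z, t::real). f i z \<le> ereal t})"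
    by (auto simp: SUP_le_iff)
  then show ?thesis
    using assms unfolding convex_ereal_def by (auto intro: convex_INT)
qed

section \<open>The weighted loss\<close>

lemma convex_weighted_loss:
  assumes w: "\<And>x y. (x, y) \<in> N \<Longrightarrow> 0 \<le> w x x0"
    and P: "\<And>d. d \<in> N \<Longrightarrow> 0 \<le> P d"
    and L: "\<And>z y. 0 \<le> L z y" "\<And>y. convex_ereal (\<lambda>z. L z y)"
  shows "convex_ereal (\<lambda>z. weighted_loss w L x0 N z P)"
proof (rule convex_ereal_if_Jensen)
  fix a b and u v :: real
  assume uv: "0 \<le> u" "0 \<le> v" "u + v = 1"
  define g where "g z = (\<lambda>(x, y). ereal (w x x0) * L z y * ereal (P (x, y)))" for z
  have loss: "weighted_loss w L x0 N z P = sum (g z) N" for z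
    unfolding weighted_loss_def g_def ..
  have g0: "0 \<le> g z d" if "d \<in> N" for z d
    using that w P L(1) by (cases d) (auto simp: g_def)
  have "g (u *\<^sub>R a + v *\<^sub>R b) d \<le> ereal u * g a d + ereal v * g b d" if d: "d \<in> N" for d
  proof -
    obtain x y where xy: "d = (x, y)" by (cases d)
    define c where "c = w x x0 * P d"
    have g: "g z d = ereal c * L z y" for z
      by (simp add: g_def xy c_def ac_simps flip: times_ereal.simps(1))
    have "0 \<le> c" using w P d by (auto simp: c_def xy)
    then have "ereal c * L (u *\<^sub>R a + v *\<^sub>R b) y
        \<le> ereal c * (ereal u * L a y + ereal v * L b y)"
      using convex_ereal_Jensen[OF L(2) L(1) uv] by (intro ereal_mult_left_mono) auto
    also have "\<dots> = ereal u * (ereal c * L a y) + ereal v * (ereal c * L b y)"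
      using uv L(1) by (simp add: ereal_right_distrib ac_simps)
    finally show ?thesis by (simp add: g)
  qed
  then have "sum (g (u *\<^sub>R a + v *\<^sub>R b)) N \<le> (\<Sum>d\<in>N. ereal u * g a d + ereal v * g b d)"
    by (rule sum_mono)
  also have "\<dots> = ereal u * sum (g a) N + ereal v * sum (g b) N"
    using g0 by (simp add: sum.distrib sum_ereal_right_distrib)
  finally show "weighted_loss w L x0 N (u *\<^sub>R a + v *\<^sub>R b) P
      \<le> ereal u * weighted_loss w L x0 N a P + ereal v * weighted_loss w L x0 N b P"
    by (simp add: loss)
qed

text \<open>The objective of the inner problem is linear in the array, also where the loss is infinite:
  all terms are nonnegative, so distributivity holds in the extended reals.\<close>

lemma weighted_loss_mix:
  assumes w: "\<And>x y. (x, y) \<in> N \<Longrightarrow> 0 \<le> w x x0"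
    and P: "\<And>d. d \<in> N \<Longrightarrow> 0 \<le> P1 d" "\<And>d. d \<in> N \<Longrightarrow> 0 \<le> P2 d"
    and L: "\<And>y. 0 \<le> L z y"
    and u: "u \<in> {0..1}"
  shows "weighted_loss w L x0 N z (mix u P1 P2)
    = ereal u * weighted_loss w L x0 N z P1 + ereal (1 - u) * weighted_loss w L x0 N z P2"
proof -
  define h where "h = (\<lambda>(x, y). ereal (w x x0) * L z y)"
  have loss: "weighted_loss w L x0 N z P = (\<Sum>d\<in>N. h d * ereal (P d))" for P
    unfolding weighted_loss_def h_def by (intro sum.cong) auto
  have h0: "0 \<le> h d" if "d \<in> N" for d
    using that w L by (cases d) (auto simp: h_def)
  have "h d * ereal (mix u P1 P2 d)
      = ereal u * (h d * ereal (P1 d)) + ereal (1 - u) * (h d * ereal (P2 d))" if "d \<in> N" for d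
  proof -
    have "h d * ereal (mix u P1 P2 d) = h d * (ereal (u * P1 d) + ereal ((1 - u) * P2 d))"
      by (simp add: mix_def)
    also have "\<dots> = h d * ereal (u * P1 d) + h d * ereal ((1 - u) * P2 d)"
      using P[OF that] u by (intro ereal_right_distrib) auto
    finally show ?thesis by (simp add: ac_simps flip: times_ereal.simps(1))
  qed
  then have "weighted_loss w L x0 N z (mix u P1 P2)
      = (\<Sum>d\<in>N. ereal u * (h d * ereal (P1 d)) + ereal (1 - u) * (h d * ereal (P2 d)))"
    unfolding loss by (rule sum.cong[OF refl])
  also have "\<dots> = ereal u * (\<Sum>d\<in>N. h d * ereal (P1 d))
      + ereal (1 - u) * (\<Sum>d\<in>N. h d * ereal (P2 d))"
    using h0 P by (simp add: sum.distrib sum_ereal_right_distrib)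
  finally show ?thesis by (simp add: loss)
qed

section \<open>Convexity of the feasible sets\<close>

lemma sum_mix: "sum (mix u f g) A = u * sum f A + (1 - u) * sum g A"
  by (simp add: mix_def sum.distrib sum_distrib_left)

lemma convex_combination_pos:
  fixes s1 s2 u :: real
  assumes "0 < s1" "0 < s2" "u \<in> {0..1}"
  shows "0 < u * s1 + (1 - u) * s2"
proof (cases "u = 0")
  case False
  then show ?thesis using assms by (intro add_pos_nonneg) auto
qed (use assms in simp)

lemma mix_nonneg_arrays:
  "P1 \<in> nonneg_arrays S \<Longrightarrow> P2 \<in> nonneg_arrays S \<Longrightarrow> u \<in> {0..1} \<Longrightarrow> mix u P1 P2 \<in> nonneg_arrays S"
  by (auto simp: nonneg_arrays_def mix_def)

lemma normalized_distribution:
  "P \<in> nonneg_arrays S \<Longrightarrow> sum P S = s \<Longrightarrow> 0 < s \<Longrightarrow> (\<lambda>d. P d / s) \<in> distributions S"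
  by (auto simp: nonneg_arrays_def distributions_def simp flip: sum_divide_distrib)

lemma nbhd_feasible_mix:
  assumes "(s1, P1) \<in> nbhd_feasible dst w ds x0 k j" "(s2, P2) \<in> nbhd_feasible dst w ds x0 k j"
    and u: "u \<in> {0..1}"
  shows "(u * s1 + (1 - u) * s2, mix u P1 P2) \<in> nbhd_feasible dst w ds x0 k j"
proof -
  let ?N = "nbhd dst ds x0"
  have F: "0 < s1" "0 < s2" "P1 \<in> nonneg_arrays (set ds)" "P2 \<in> nonneg_arrays (set ds)"
    "sum P1 (set ds) = s1" "sum P2 (set ds) = s2"
    "(\<Sum>(x, y)\<in>?N j. w x x0 * P1 (x, y)) = 1" "(\<Sum>(x, y)\<in>?N j. w x x0 * P2 (x, y)) = 1"
    "s1 * (real k / real (length ds)) \<le> sum P1 (?N j)"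
    "s2 * (real k / real (length ds)) \<le> sum P2 (?N j)"
    "sum P1 (?N (j - 1)) \<le> s1 * ((real k - 1) / real (length ds))"
    "sum P2 (?N (j - 1)) \<le> s2 * ((real k - 1) / real (length ds))"
    using assms(1,2) unfolding nbhd_feasible_def by auto
  have u01: "0 \<le> u" "0 \<le> 1 - u" using u by auto
  have "0 < u * s1 + (1 - u) * s2"
    using convex_combination_pos F(1,2) u by blast
  moreover have "(\<Sum>(x, y)\<in>?N j. w x x0 * mix u P1 P2 (x, y)) = 1"
  proof -
    have "(\<Sum>(x, y)\<in>?N j. w x x0 * mix u P1 P2 (x, y))
        = u * (\<Sum>(x, y)\<in>?N j. w x x0 * P1 (x, y)) + (1 - u) * (\<Sum>(x, y)\<in>?N j. w x x0 * P2 (x, y))"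
      by (simp add: mix_def case_prod_beta algebra_simps sum.distrib sum_distrib_left sum_subtractf)
    then show ?thesis using F(7,8) by simp
  qed
  moreover have "(u * s1 + (1 - u) * s2) * (real k / real (length ds)) \<le> sum (mix u P1 P2) (?N j)"
    using add_mono[OF mult_left_mono[OF F(9) u01(1)] mult_left_mono[OF F(10) u01(2)]]
    unfolding sum_mix by (simp add: distrib_right mult.assoc add_divide_distrib)
  moreover have "sum (mix u P1 P2) (?N (j - 1))
      \<le> (u * s1 + (1 - u) * s2) * ((real k - 1) / real (length ds))"
    using add_mono[OF mult_left_mono[OF F(11) u01(1)] mult_left_mono[OF F(12) u01(2)]]
    unfolding sum_mix by (simp add: distrib_right mult.assoc add_divide_distrib)
  ultimately show ?thesis
    using mix_nonneg_arrays[OF F(3,4) u] F(5,6) by (simp add: nbhd_feasible_def sum_mix)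
qed

text \<open>The normalization of a mixture of arrays is again a mixture of the normalized
  arrays, each weighted by its share of the total mass. Multiplying the convexity
  inequality of \<open>R\<close> for that mixture by the total mass cancels the normalization.\<close>

lemma perspective_distance_convex:
  assumes R: "distribution_distance S R" and D: "D \<in> distributions S"
    and P1: "P1 \<in> nonneg_arrays S" "sum P1 S = s1" "0 < s1"
    and P2: "P2 \<in> nonneg_arrays S" "sum P2 S = s2" "0 < s2"
    and u: "u \<in> {0..1}"
  shows "ereal (u * s1 + (1 - u) * s2) * R (\<lambda>d. mix u P1 P2 d / (u * s1 + (1 - u) * s2)) D
    \<le> ereal u * (ereal s1 * R (\<lambda>d. P1 d / s1) D) + ereal (1 - u) * (ereal s2 * R (\<lambda>d. P2 d / s2) D)"
proof -
  define s where "s = u * s1 + (1 - u) * s2"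
  define v where "v = u * s1 / s"
  have s: "0 < s"
    using convex_combination_pos P1(3) P2(3) u unfolding s_def by blast
  have v': "1 - v = (1 - u) * s2 / s"
    using s by (simp add: v_def field_simps) (simp add: s_def algebra_simps)
  have "0 \<le> v" "0 \<le> 1 - v" using s P1 P2 u unfolding v' by (auto simp: v_def)
  then have v: "v \<in> {0..1}" by simp
  let ?D1 = "\<lambda>d. P1 d / s1" and ?D2 = "\<lambda>d. P2 d / s2"
  have D12: "?D1 \<in> distributions S" "?D2 \<in> distributions S"
    using normalized_distribution P1 P2 by blast+
  have nonneg: "0 \<le> R ?D1 D" "0 \<le> R ?D2 D"
    using R D D12 by (auto simp: distribution_distance_def)
  \<comment> \<open>\<open>v\<close> is the share of the first array in the total mass \<open>s\<close>, not the original weight \<open>u\<close>\<close>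
  have "(\<lambda>d. mix u P1 P2 d / s) = mix v ?D1 ?D2"
    using P1(3) P2(3) unfolding mix_def v' by (auto simp: v_def add_divide_distrib)
  then have "ereal s * R (\<lambda>d. mix u P1 P2 d / s) D
      \<le> ereal s * (ereal v * R ?D1 D + ereal (1 - v) * R ?D2 D)"
    using R D D12 v s by (auto simp: distribution_distance_def intro!: ereal_mult_left_mono)
  also have "\<dots> = ereal (s * v) * R ?D1 D + ereal (s * (1 - v)) * R ?D2 D"
    using v nonneg by (simp add: ereal_right_distrib mult.assoc flip: times_ereal.simps(1))
  also have "s * v = u * s1"
    using s by (simp add: v_def)
  also have "s * (1 - v) = (1 - u) * s2"
    using s by (simp add: v')
  finally show ?thesis
    by (simp add: s_def mult.assoc flip: times_ereal.simps(1))
qed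

lemma robust_feasible_mix:
  assumes R: "distribution_distance (set ds) R" and D: "D \<in> distributions (set ds)"
    and F: "(s1, P1) \<in> robust_feasible dst w ds x0 k R r j D"
      "(s2, P2) \<in> robust_feasible dst w ds x0 k R r j D"
    and u: "u \<in> {0..1}"
  shows "(u * s1 + (1 - u) * s2, mix u P1 P2) \<in> robust_feasible dst w ds x0 k R r j D"
proof -
  have N: "(s1, P1) \<in> nbhd_feasible dst w ds x0 k j" "(s2, P2) \<in> nbhd_feasible dst w ds x0 k j"
    and le: "ereal s1 * R (\<lambda>d. P1 d / s1) D \<le> ereal (s1 * r)"
      "ereal s2 * R (\<lambda>d. P2 d / s2) D \<le> ereal (s2 * r)"
    using F by (auto simp: robust_feasible_def)
  have "ereal (u * s1 + (1 - u) * s2) * R (\<lambda>d. mix u P1 P2 d / (u * s1 + (1 - u) * s2)) D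
      \<le> ereal u * (ereal s1 * R (\<lambda>d. P1 d / s1) D) + ereal (1 - u) * (ereal s2 * R (\<lambda>d. P2 d / s2) D)"
    using N by (intro perspective_distance_convex[OF R D _ _ _ _ _ _ u]) (auto simp: nbhd_feasible_def)
  also have "\<dots> \<le> ereal u * ereal (s1 * r) + ereal (1 - u) * ereal (s2 * r)"
    using u by (intro add_mono ereal_mult_left_mono le) auto
  also have "\<dots> = ereal ((u * s1 + (1 - u) * s2) * r)"
    by (simp add: algebra_simps)
  finally show ?thesis
    using nbhd_feasible_mix[OF N u] by (simp add: robust_feasible_def)
qed

section \<open>Exchanging the maximum and the supremum\<close>

text \<open>With the iterated supremum on the right flattened to one over \<open>(D, s)\<close>, both sides range over
  the same values: the correspondence is \<open>P = s * D\<close>, with \<open>D = P / s\<close> recovered from \<open>P\<close>. Since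
  arrays vanish outside the data, the constraint \<open>s * D = P\<close> on the data determines \<open>D\<close> as a total
  function, as required to insert \<open>P / s\<close> into \<open>R\<close>.\<close>

lemma partial_robust_cost_eq_SUP:
  "partial_robust_cost dst w L ds x0 k R r j D0 z
    = (SUP D\<in>{D \<in> distributions (set ds). R D D0 \<le> ereal r}. partial_estimator dst w L ds x0 k j D z)"
    (is "?lhs = ?rhs")
proof (rule antisym)
  have scale: "ereal s * c \<le> ereal (s * r) \<longleftrightarrow> c \<le> ereal r" if "0 < s" for s c
    using that by (cases c) auto
  show "?lhs \<le> ?rhs"
    unfolding partial_robust_cost_def
  proof (rule Sup_least, clarify)
    fix s P assume "(s, P) \<in> robust_feasible dst w ds x0 k R r j D0"
    then have N: "(s, P) \<in> nbhd_feasible dst w ds x0 k j"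
      and le: "ereal s * R (\<lambda>d. P d / s) D0 \<le> ereal (s * r)"
      by (auto simp: robust_feasible_def)
    have P: "P \<in> nonneg_arrays (set ds)" "sum P (set ds) = s" "0 < s"
      using N by (auto simp: nbhd_feasible_def)
    let ?D = "\<lambda>d. P d / s"
    have "weighted_loss w L x0 (nbhd dst ds x0 j) z P \<le> partial_estimator dst w L ds x0 k j ?D z"
      unfolding partial_estimator_def
      by (intro Sup_upper CollectI exI[of _ s] exI[of _ P]) (use N P in auto)
    also have "\<dots> \<le> ?rhs"
      using normalized_distribution[OF P] le scale[OF P(3)] by (intro SUP_upper) auto
    finally show "weighted_loss w L x0 (nbhd dst ds x0 j) z P \<le> ?rhs" .
  qed
  show "?rhs \<le> ?lhs"
  proof (rule SUP_least, clarify)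
    fix D assume D: "D \<in> distributions (set ds)" and le: "R D D0 \<le> ereal r"
    show "partial_estimator dst w L ds x0 k j D z \<le> ?lhs"
      unfolding partial_estimator_def
    proof (rule Sup_least, clarify)
      fix s P assume N: "(s, P) \<in> nbhd_feasible dst w ds x0 k j" and sD: "\<forall>d\<in>set ds. s * D d = P d"
      have s: "0 < s" using N by (auto simp: nbhd_feasible_def)
      have "P d / s = D d" for d
      proof (cases "d \<in> set ds")
        case True
        then have "P d = s * D d" using sD by simp
        then show ?thesis using s by simp
      next
        case False
        then show ?thesis
          using N D
          by (auto simp: nbhd_feasible_def distributions_def nonneg_arrays_def simp del: split_paired_All)
      qed
      then have "(\<lambda>d. P d / s) = D" by blast
      then have "(s, P) \<in> robust_feasible dst w ds x0 k R r j D0"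
        using N le scale[OF s] by (simp add: robust_feasible_def)
      then show "weighted_loss w L x0 (nbhd dst ds x0 j) z P \<le> ?lhs"
        unfolding partial_robust_cost_def by (intro Sup_upper) auto
    qed
  qed
qed

lemma robust_cost_eq_Max:
  assumes "1 \<le> length ds"
  shows "robust_cost dst w L ds x0 k R r D0 z
    = (MAX j\<in>{1..length ds}. partial_robust_cost dst w L ds x0 k R r j D0 z)"
proof -
  let ?A = "{D \<in> distributions (set ds). R D D0 \<le> ereal r}"
  have J: "(MAX j\<in>{1..length ds}. f j) = (SUP j\<in>{1..length ds}. f j)" for f :: "nat \<Rightarrow> ereal"
    using assms by (intro Max_Sup) auto
  have "robust_cost dst w L ds x0 k R r D0 z = (SUP D\<in>?A. estimator dst w L ds x0 k D z)"
    unfolding robust_cost_def by (rule arg_cong[of _ _ Sup]) auto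
  also have "\<dots> = (SUP D\<in>?A. SUP j\<in>{1..length ds}. partial_estimator dst w L ds x0 k j D z)"
    by (simp only: estimator_def J)
  also have "\<dots> = (SUP j\<in>{1..length ds}. SUP D\<in>?A. partial_estimator dst w L ds x0 k j D z)"
    by (rule SUP_commute)
  finally show ?thesis
    by (simp only: J partial_robust_cost_eq_SUP)
qed

section \<open>The convex reformulation\<close>

theorem theorem2:
  fixes \<Omega> :: "((real ^ 'dx) \<times> (real ^ 'dy)) set"
    and ds :: "((real ^ 'dx) \<times> (real ^ 'dy)) list"
    and x0 :: "real ^ 'dx"
    and dst :: "(real ^ 'dx) \<times> (real ^ 'dy) \<Rightarrow> real ^ 'dx \<Rightarrow> real"
    and w :: "real ^ 'dx \<Rightarrow> real ^ 'dx \<Rightarrow> real"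
    and L :: "real ^ 'dz \<Rightarrow> real ^ 'dy \<Rightarrow> ereal"
    and R :: "((real ^ 'dx) \<times> (real ^ 'dy) \<Rightarrow> real) \<Rightarrow> ((real ^ 'dx) \<times> (real ^ 'dy) \<Rightarrow> real) \<Rightarrow> ereal"
    and r :: real
    and k :: nat
  assumes "length ds \<ge> 1" and "set ds \<subseteq> \<Omega>"
    and "\<And>d. d \<in> \<Omega> \<Longrightarrow> 0 \<le> dst d x0"
    and "\<And>d d'. d \<in> \<Omega> \<Longrightarrow> d' \<in> \<Omega> \<Longrightarrow> dst d x0 = dst d' x0 \<longleftrightarrow> d = d'"
    and "\<And>x y. (x, y) \<in> \<Omega> \<Longrightarrow> 0 < w x x0"
    and "\<And>z y. 0 \<le> L z y"
    and "\<And>y. convex_ereal (\<lambda>z. L z y)"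
    and "\<And>z. L z \<in> borel_measurable borel"
    and "k \<in> {1..length ds}"
    and "distribution_distance (set ds) R"
    and "0 \<le> r"
  shows "argmin_set (robust_cost dst w L ds x0 k R r (empirical ds))
           = argmin_set (\<lambda>z. MAX j\<in>{1..length ds}.
               partial_robust_cost dst w L ds x0 k R r j (empirical ds) z)
       \<and> convex_ereal (\<lambda>z. MAX j\<in>{1..length ds}.
               partial_robust_cost dst w L ds x0 k R r j (empirical ds) z)
       \<and> (\<forall>j\<in>{1..length ds}. \<forall>D\<in>distributions (set ds). \<forall>z.
             concave_maximization (robust_feasible dst w ds x0 k R r j D)
               (\<lambda>(s, P). weighted_loss w L x0 (nbhd dst ds x0 j) z P))"
proof (intro conjI ballI allI)
  let ?D0 = "empirical ds"
  let ?c = "partial_robust_cost dst w L ds x0 k R r"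
  note w = assms(5) and L = assms(6,7) and R = assms(10)
  have w0: "0 \<le> w x x0" if "(x, y) \<in> nbhd dst ds x0 j" for x y j
    using that assms(2) by (auto simp: nbhd_def split: if_splits intro!: less_imp_le w)
  have P0: "0 \<le> P d" if "(s, P) \<in> robust_feasible dst w ds x0 k R r j D" for s P d j D
  proof -
    have "P \<in> nonneg_arrays (set ds)"
      using that by (auto simp: robust_feasible_def nbhd_feasible_def)
    then show ?thesis
      by (cases "d \<in> set ds") (simp_all add: nonneg_arrays_def del: split_paired_All)
  qed

  show "argmin_set (robust_cost dst w L ds x0 k R r ?D0)
      = argmin_set (\<lambda>z. MAX j\<in>{1..length ds}. ?c j ?D0 z)"
    using robust_cost_eq_Max[OF assms(1)] by (intro arg_cong[of _ _ argmin_set] ext)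

  have c: "?c j ?D0 z = (SUP (s, P)\<in>robust_feasible dst w ds x0 k R r j ?D0.
      weighted_loss w L x0 (nbhd dst ds x0 j) z P)" for j z
    unfolding partial_robust_cost_def by (rule arg_cong[of _ _ Sup]) force
  have "convex_ereal (\<lambda>z. ?c j ?D0 z)" for j
    unfolding c case_prod_beta
    by (intro convex_ereal_SUP convex_weighted_loss L w0) (auto intro: P0)
  then have "convex_ereal (\<lambda>z. SUP j\<in>{1..length ds}. ?c j ?D0 z)"
    by (intro convex_ereal_SUP)
  moreover have "(MAX j\<in>{1..length ds}. ?c j ?D0 z) = (SUP j\<in>{1..length ds}. ?c j ?D0 z)" for z
    using assms(1) by (intro Max_Sup) auto
  ultimately show "convex_ereal (\<lambda>z. MAX j\<in>{1..length ds}. ?c j ?D0 z)"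
    by simp

  fix j D z
  assume D: "D \<in> distributions (set ds)"
  show "concave_maximization (robust_feasible dst w ds x0 k R r j D)
      (\<lambda>(s, P). weighted_loss w L x0 (nbhd dst ds x0 j) z P)"
    unfolding concave_maximization_def
  proof (clarify, intro conjI)
    fix s1 P1 s2 P2 and u :: real
    assume F: "(s1, P1) \<in> robust_feasible dst w ds x0 k R r j D"
        "(s2, P2) \<in> robust_feasible dst w ds x0 k R r j D"
      and u: "u \<in> {0..1}"
    show "(u * s1 + (1 - u) * s2, mix u P1 P2) \<in> robust_feasible dst w ds x0 k R r j D"
      by (rule robust_feasible_mix[OF R D F u])
    show "ereal u * weighted_loss w L x0 (nbhd dst ds x0 j) z P1
        + ereal (1 - u) * weighted_loss w L x0 (nbhd dst ds x0 j) z P2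
        \<le> weighted_loss w L x0 (nbhd dst ds x0 j) z (mix u P1 P2)"
      by (rule eq_refl, rule weighted_loss_mix[symmetric])
        (rule w0 P0[OF F(1)] P0[OF F(2)] L(1) u, assumption?)+
  qed
qed

end
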